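(* Let $n\ge 2$. For $B\ge1$ let $M_B$ be the set of $n\times n$ integer matrices all of whose entries are bounded in absolute value by $B$, and let $N(n,B)$ be the number of matrices in $M_B$ whose characteristic polynomial is reducible over $\mathbb{Z}$. Then $N(n,B)/|M_B|\to 0$ as $B\to\infty$. *)

theory Defs
  imports "Jordan_Normal_Form.Char_Poly"
begin

definition bounded_int_mats :: "nat \<Rightarrow> real \<Rightarrow> int mat set" where
  "bounded_int_mats n B = {A \<in> carrier_mat n n. \<forall>i<n. \<forall>j<n. real_of_int \<bar>A $$ (i, j)\<bar> \<le> B}"

definition N_reducible :: "nat \<Rightarrow> real \<Rightarrow> nat" where
  "N_reducible n B = card {A \<in> bounded_int_mats n B. \<not> irreducible (char_poly A)}"

end

theory Submission
  imports Defs "Berlekamp_Zassenhaus.Poly_Mod"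
begin

text \<open>For each prime p, a fixed positive proportion of the matrices modulo p have irreducible
  characteristic polynomial. Indeed, a matrix A modulo p for which the first basis vector is cyclic is
  determined by its Krylov basis K, an invertible matrix with first column e_1, and by its
  characteristic polynomial f, through A = K C_f K^{-1} with C_f the companion matrix; there are
  at least 2^{-n} p^{n(n-1)} choices for K and at least p^n/(2n) irreducible choices for f.
  By the Chinese remainder theorem the conditions at different primes are independent, so the
  density of integer matrices whose characteristic polynomial is reducible modulo each of m
  primes is at most (1 - c)^m with c independent of the primes, and m is arbitrary.\<close>

section \<open>The sieve\<close>

text \<open>Because \<open>c\<close> does not depend on the primes, a finite sieve suffices: with
  \<open>c = 1 / (2^n * n)\<close>, some \<open>m\<close> makes \<open>(1 - c)^m\<close> small, and
  only afterwards does \<open>B\<close> grow. In this constant, \<open>2^(n-1)\<close> comes from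
  \<open>p \<le> 2 * (p - 1)\<close>, applied once for each column of \<open>K\<close> after the
  first, and \<open>2 * n\<close> from setting Gauss' count of irreducibles against a geometric
  series, which is where \<open>p \<ge> 3\<close> enters. A reducible characteristic polynomial
  avoids the good residues modulo every prime because a nontrivial factorisation of a monic integer
  polynomial can be taken with monic factors, whose degrees survive reduction. Since the prime
  varies inside one induction, all objects stay integral with canonical residues: polynomials
  through \<open>Mp\<close>, matrices through \<open>mat_mod\<close>, and conjugation as a
  congruence between \<open>A * K\<close> and \<open>K * companion f\<close>. The counts of matrices
  are one-sided, upper bounds for residues and boxes, lower bounds for good matrices, so injections
  are enough.\<close>

definition mats_over :: "nat \<Rightarrow> 'a set \<Rightarrow> 'a mat set" where
  "mats_over n X = {A \<in> carrier_mat n n. \<forall>i<n. \<forall>j<n. A $$ (i, j) \<in> X}"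

lemma mats_over_bij:
  "bij_betw (\<lambda>g. mat n n g) (({..<n} \<times> {..<n}) \<rightarrow>\<^sub>E X) (mats_over n X)"
proof (rule bij_betwI[where g = "\<lambda>A. restrict (\<lambda>ij. A $$ ij) ({..<n} \<times> {..<n})"])
  show "(\<lambda>g. mat n n g) \<in> (({..<n} \<times> {..<n}) \<rightarrow>\<^sub>E X) \<rightarrow> mats_over n X"
    by (auto simp: mats_over_def PiE_iff)
  show "(\<lambda>A. restrict (\<lambda>ij. A $$ ij) ({..<n} \<times> {..<n})) \<in> mats_over n X \<rightarrow> (({..<n} \<times> {..<n}) \<rightarrow>\<^sub>E X)"
    by (intro funcsetI) (auto simp: mats_over_def PiE_iff extensional_def)
  show "restrict (\<lambda>ij. mat n n g $$ ij) ({..<n} \<times> {..<n}) = g"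
    if "g \<in> ({..<n} \<times> {..<n}) \<rightarrow>\<^sub>E X" for g
    using that by (intro ext) (auto simp: PiE_iff extensional_def restrict_def, metis+)
  show "mat n n (restrict (\<lambda>ij. A $$ ij) ({..<n} \<times> {..<n})) = A" if "A \<in> mats_over n X" for A
    using that by (intro eq_matI) (auto simp: mats_over_def)
qed

lemma finite_mats_over: "finite X \<Longrightarrow> finite (mats_over n X)"
  using bij_betw_finite[OF mats_over_bij] by (metis finite_PiE finite_SigmaI finite_lessThan)

lemma card_mats_over: "finite X \<Longrightarrow> card (mats_over n X) = card X ^ (n * n)"
  using bij_betw_same_card[OF mats_over_bij, of n X]
  by (simp add: card_PiE card_cartesian_product)

text \<open>Residues are integers in \<open>{0..<q}\<close> for positive \<open>q\<close>, so
  reductions modulo different \<open>q\<close> live in one type and can be composed.\<close>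

definition mat_mod :: "int \<Rightarrow> int mat \<Rightarrow> int mat" where
  "mat_mod q A = map_mat (\<lambda>x. x mod q) A"

lemma mat_mod_carrier [simp]: "mat_mod q A \<in> carrier_mat n m \<longleftrightarrow> A \<in> carrier_mat n m"
  by (auto simp: mat_mod_def)

lemma mat_mod_in_mats_over: "A \<in> carrier_mat n n \<Longrightarrow> q > 0 \<Longrightarrow> mat_mod q A \<in> mats_over n {0..<q}"
  by (auto simp: mat_mod_def mats_over_def)

lemma mat_mod_eq_iff:
  assumes "A \<in> carrier_mat n m" "B \<in> carrier_mat n m"
  shows "mat_mod q A = mat_mod q B \<longleftrightarrow> (\<forall>i<n. \<forall>j<m. q dvd A $$ (i, j) - B $$ (i, j))"
  using assms by (auto simp: mat_mod_def mat_eq_iff mod_eq_dvd_iff)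

text \<open>An upper bound uses the injective half of the Chinese remainder theorem: entries with
  equal residues modulo \<open>P\<close> and \<open>Q\<close> differ by a multiple of
  \<open>P * Q\<close>, and both lie in \<open>{0..<P * Q}\<close>.\<close>

lemma crt_mats_card:
  fixes P Q :: int
  assumes "algebraic_semidom_class.coprime P Q" "P > 0" "Q > 0"
    and S: "S \<subseteq> mats_over n {0..<P * Q}"
    and X: "finite X" "\<And>A. A \<in> S \<Longrightarrow> mat_mod P A \<in> X"
    and Y: "finite Y" "\<And>A. A \<in> S \<Longrightarrow> mat_mod Q A \<in> Y"
  shows "card S \<le> card X * card Y"
proof -
  have "inj_on (\<lambda>A. (mat_mod P A, mat_mod Q A)) S"
  proof (rule inj_onI)
    fix A B assume A: "A \<in> S" and B: "B \<in> S"
      and eq: "(mat_mod P A, mat_mod Q A) = (mat_mod P B, mat_mod Q B)"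
    have c: "A \<in> carrier_mat n n" "B \<in> carrier_mat n n"
      using A B S by (auto simp: mats_over_def)
    have "A $$ (i,j) = B $$ (i,j)" if "i < n" "j < n" for i j
    proof -
      have "P * Q dvd A $$ (i,j) - B $$ (i,j)"
        using eq that c assms(1) by (intro divides_mult) (auto simp: mat_mod_eq_iff)
      then have "A $$ (i,j) mod (P * Q) = B $$ (i,j) mod (P * Q)"
        by (simp add: mod_eq_dvd_iff)
      then show ?thesis using A B S that by (auto simp: mats_over_def subset_iff)
    qed
    then show "A = B" using c by (intro eq_matI) auto
  qed
  then have "card S \<le> card (X \<times> Y)"
    using X Y by (intro card_inj_on_le) auto
  then show ?thesis by (simp add: card_cartesian_product)
qed

text \<open>\<open>G\<close> holds residues that certify goodness, \<open>S\<close> the residues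
  that bad matrices may still occupy. Each new prime multiplies the surviving density by at most
  \<open>1 - c\<close>.\<close>

lemma sieve_residues:
  fixes c :: real and b :: nat
  assumes c: "0 \<le> c" "c \<le> 1"
    and local: "\<And>p. prime p \<Longrightarrow> p \<ge> int b \<Longrightarrow>
      \<exists>G \<subseteq> mats_over n {0..<p}. real (card G) \<ge> c * real_of_int p ^ (n * n) \<and>
        (\<forall>A \<in> carrier_mat n n. mat_mod p A \<in> G \<longrightarrow> \<not> bad A)"
  shows "\<exists>Q>0. \<exists>S \<subseteq> mats_over n {0..<Q}. real (card S) \<le> (1 - c) ^ m * real_of_int Q ^ (n * n) \<and>
        (\<forall>A \<in> carrier_mat n n. bad A \<longrightarrow> mat_mod Q A \<in> S)"
proof (induction m)
  case 0
  \<comment> \<open>Modulus 1 has a single residue matrix, so the sieve starts at density 1.\<close>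
  have "real (card (mats_over n {0..<1::int})) \<le> (1 - c) ^ 0 * real_of_int 1 ^ (n * n)"
    by (simp add: card_mats_over)
  then show ?case using mat_mod_in_mats_over[of _ n 1]
    by (intro exI[of _ 1] conjI exI[of _ "mats_over n {0..<1::int}"]) auto
next
  case (Suc m)
  then obtain Q S where Q: "Q > 0" "S \<subseteq> mats_over n {0..<Q}"
    "real (card S) \<le> (1 - c) ^ m * real_of_int Q ^ (n * n)"
    "\<And>A. A \<in> carrier_mat n n \<Longrightarrow> bad A \<Longrightarrow> mat_mod Q A \<in> S" by blast
  \<comment> \<open>Exceeding \<open>Q\<close> keeps the prime from dividing \<open>Q\<close>, hence
    coprime to it; exceeding \<open>b\<close> makes \<open>local\<close> applicable.\<close>
  obtain p' :: nat where p': "prime p'" "p' > b + nat Q"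
    using bigger_prime by blast
  define p where "p = int p'"
  have p: "prime p" "p \<ge> int b" "p > Q" "p > 0"
    using p' Q(1) by (auto simp: p_def)
  obtain G where G: "G \<subseteq> mats_over n {0..<p}" "real (card G) \<ge> c * real_of_int p ^ (n * n)"
    "\<And>A. A \<in> carrier_mat n n \<Longrightarrow> mat_mod p A \<in> G \<Longrightarrow> \<not> bad A"
    using local[OF p(1,2)] by blast
  define S' where "S' = {A \<in> mats_over n {0..<Q * p}. mat_mod Q A \<in> S \<and> mat_mod p A \<in> mats_over n {0..<p} - G}"
  have "algebraic_semidom_class.coprime p Q"
    by (rule prime_imp_coprime[OF p(1)]) (use p Q(1) zdvd_not_zless in blast)
  then have cop: "algebraic_semidom_class.coprime Q p"
    by (simp add: algebraic_semidom_class.coprime_commute)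
  then have "card S' \<le> card S * card (mats_over n {0..<p} - G)"
    using p Q(1) cop finite_subset[OF Q(2)] by (intro crt_mats_card[of Q p _ n])
      (auto simp: S'_def finite_mats_over)
  then have "real (card S') \<le> real (card S) * real (card (mats_over n {0..<p} - G))"
    by (metis of_nat_le_iff of_nat_mult)
  also have "real (card (mats_over n {0..<p} - G)) = real_of_int p ^ (n * n) - real (card G)"
  proof -
    have "card G \<le> card (mats_over n {0..<p})"
      using G(1) by (intro card_mono finite_mats_over) auto
    moreover have "card (mats_over n {0..<p} - G) = card (mats_over n {0..<p}) - card G"
      using finite_subset[OF G(1)] G(1) by (intro card_Diff_subset) (auto simp: finite_mats_over)
    ultimately show ?thesis using p by (simp add: card_mats_over of_nat_diff)
  qed
  also have "real (card S) * (real_of_int p ^ (n * n) - real (card G))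
     \<le> ((1 - c) ^ m * real_of_int Q ^ (n * n)) * ((1 - c) * real_of_int p ^ (n * n))"
  proof (rule mult_mono)
    show "real_of_int p ^ (n * n) - real (card G) \<le> (1 - c) * real_of_int p ^ (n * n)"
      using G(2) by (simp add: algebra_simps)
    have "card G \<le> card (mats_over n {0..<p})"
      using G(1) by (intro card_mono finite_mats_over) auto
    then have "real (card G) \<le> real (nat p ^ (n * n))" by (simp add: card_mats_over)
    then show "0 \<le> real_of_int p ^ (n * n) - real (card G)" using p by simp
  qed (use Q c in auto)
  finally have "real (card S') \<le> (1 - c) ^ Suc m * real_of_int (Q * p) ^ (n * n)"
    by (simp add: power_mult_distrib mult_ac)
  moreover have "mat_mod (Q * p) A \<in> S'" if "A \<in> carrier_mat n n" "bad A" for A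
  proof -
    have *: "mat_mod Q (mat_mod (Q * p) A) = mat_mod Q A" "mat_mod p (mat_mod (Q * p) A) = mat_mod p A"
      using that by (auto simp: mat_mod_def mod_mod_cancel intro!: eq_matI)
    show ?thesis using that p Q(1,4) G(3)
      by (auto simp: S'_def * mat_mod_in_mats_over)
  qed
  ultimately show ?case using Q(1) p
    by (intro exI[of _ "Q * p"] conjI exI[of _ S']) (auto simp: S'_def)
qed

section \<open>From residue classes to boxes of integer matrices\<close>

lemma card_box_le:
  fixes k Q :: int
  assumes Q: "Q > 0" and k: "k \<ge> 0" and S: "finite S"
    and T: "T \<subseteq> mats_over n {-k..k}" "\<And>A. A \<in> T \<Longrightarrow> mat_mod Q A \<in> S"
  shows "real (card T) \<le> (real_of_int (2 * k + 2 * Q) / real_of_int Q) ^ (n * n) * real (card S)"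
proof -
  let ?D = "{(-k) div Q..k div Q}"
  \<comment> \<open>Quotient and residue determine each entry; blocks of length \<open>Q\<close> cut
    off at the ends of the box are counted whole.\<close>
  have "inj_on (\<lambda>A. (map_mat (\<lambda>x. x div Q) A, mat_mod Q A)) T"
  proof (rule inj_onI)
    fix A B assume A: "A \<in> T" and B: "B \<in> T"
      and eq: "(map_mat (\<lambda>x. x div Q) A, mat_mod Q A) = (map_mat (\<lambda>x. x div Q) B, mat_mod Q B)"
    have c: "A \<in> carrier_mat n n" "B \<in> carrier_mat n n"
      using A B T by (auto simp: mats_over_def)
    have "A $$ (i,j) = B $$ (i,j)" if "i < n" "j < n" for i j
    proof -
      have "A $$ (i,j) div Q = B $$ (i,j) div Q" "A $$ (i,j) mod Q = B $$ (i,j) mod Q"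
        using eq that c by (auto simp: mat_eq_iff mat_mod_def)
      then show ?thesis by (metis div_mult_mod_eq)
    qed
    then show "A = B" using c by (intro eq_matI) auto
  qed
  moreover have "map_mat (\<lambda>x. x div Q) A \<in> mats_over n ?D" if "A \<in> T" for A
  proof -
    have A: "A \<in> carrier_mat n n" "\<And>i j. i < n \<Longrightarrow> j < n \<Longrightarrow> -k \<le> A $$ (i, j) \<and> A $$ (i, j) \<le> k"
      using that T(1) by (auto simp: mats_over_def)
    show ?thesis unfolding mats_over_def
      using A Q by (auto intro!: zdiv_mono1)
  qed
  ultimately have "card T \<le> card (mats_over n ?D \<times> S)"
    using S T(2) by (intro card_inj_on_le) (auto simp: finite_mats_over)
  then have "real (card T) \<le> real (card ?D) ^ (n * n) * real (card S)"
    by (metis card_cartesian_product card_mats_over finite_atLeastAtMost_int of_nat_le_iff of_nat_mult of_nat_power)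
  also have "\<dots> \<le> (real_of_int (2 * k + 2 * Q) / real_of_int Q) ^ (n * n) * real (card S)"
  proof (intro mult_right_mono power_mono)
    have "(-k) div Q \<le> k div Q" using Q k by (intro zdiv_mono1) auto
    then have "real (card ?D) = real_of_int (k div Q) - real_of_int ((-k) div Q) + 1"
      by simp
    \<comment> \<open>Rounding down the lower quotient costs at most 1 and the closed interval adds
      1: together the \<open>2 * Q\<close> in the numerator.\<close>
    also have "\<dots> \<le> k / Q - ((-k) / Q - 1) + 1"
      using Q real_of_int_div4[of k Q] real_of_int_div3[of "-k" Q] by linarith
    also have "\<dots> = real_of_int (2 * k + 2 * Q) / real_of_int Q"
      using Q by (simp add: add_divide_distrib)
    finally show "real (card ?D) \<le> real_of_int (2 * k + 2 * Q) / real_of_int Q" .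
  qed auto
  finally show ?thesis .
qed

lemma bounded_int_mats_eq: "bounded_int_mats n B = mats_over n {- \<lfloor>B\<rfloor>..\<lfloor>B\<rfloor>}"
proof -
  have "real_of_int \<bar>x\<bar> \<le> B \<longleftrightarrow> x \<in> {- \<lfloor>B\<rfloor>..\<lfloor>B\<rfloor>}" for x
    unfolding le_floor_iff[symmetric] by auto
  then show ?thesis unfolding bounded_int_mats_def mats_over_def by simp
qed

text \<open>\<open>Q\<close> is fixed from \<epsilon> before \<open>B\<close> grows. Covering the
  box by whole blocks costs a factor of at most \<open>(1 + 2 * Q / B) ^ (n * n)\<close>, eventually
  below 2; hence \<open>m\<close> is chosen for \<epsilon>/2.\<close>

lemma sieve_density:
  fixes c :: real and b :: nat
  assumes c: "0 < c" "c \<le> 1"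
    and local: "\<And>p. prime p \<Longrightarrow> p \<ge> int b \<Longrightarrow>
      \<exists>G \<subseteq> mats_over n {0..<p}. real (card G) \<ge> c * real_of_int p ^ (n * n) \<and>
        (\<forall>A \<in> carrier_mat n n. mat_mod p A \<in> G \<longrightarrow> \<not> bad A)"
  shows "((\<lambda>B::real. real (card {A \<in> bounded_int_mats n B. bad A}) / real (card (bounded_int_mats n B)))
           \<longlongrightarrow> 0) at_top"
proof (rule tendstoI)
  fix \<epsilon> :: real assume \<epsilon>: "\<epsilon> > 0"
  have "(\<lambda>m. (1 - c) ^ m) \<longlonglongrightarrow> 0" using c by (intro LIMSEQ_power_zero) auto
  then have "\<forall>\<^sub>F m in sequentially. (1 - c) ^ m < \<epsilon> / 2"
    by (rule order_tendstoD) (use \<epsilon> in simp)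
  then obtain m where m: "(1 - c) ^ m < \<epsilon> / 2" by (auto simp: eventually_sequentially)
  obtain Q S where Q: "Q > 0" "S \<subseteq> mats_over n {0..<Q}"
    "real (card S) \<le> (1 - c) ^ m * real_of_int Q ^ (n * n)"
    "\<And>A. A \<in> carrier_mat n n \<Longrightarrow> bad A \<Longrightarrow> mat_mod Q A \<in> S"
    using sieve_residues[of c b n bad m] c local by auto
  have "((\<lambda>B::real. (1 + 2 * Q / B) ^ (n * n)) \<longlongrightarrow> (1 + 0) ^ (n * n)) at_top"
    by (intro tendsto_power tendsto_add tendsto_const tendsto_divide_0[OF tendsto_const]
       filterlim_at_top_imp_at_infinity filterlim_ident)
  then have ev: "\<forall>\<^sub>F B::real in at_top. (1 + 2 * Q / B) ^ (n * n) < 2"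
    by (auto simp: order_tendsto_iff)
  show "\<forall>\<^sub>F B::real in at_top. dist (real (card {A \<in> bounded_int_mats n B. bad A}) / real (card (bounded_int_mats n B))) 0 < \<epsilon>"
    using ev eventually_ge_at_top[of 1]
  proof eventually_elim
    case (elim B)
    define k where "k = \<lfloor>B\<rfloor>"
    have k: "k \<ge> 1" "B \<le> 2 * k + 1" using elim by (auto simp: k_def le_floor_iff) linarith
    let ?T = "{A \<in> bounded_int_mats n B. bad A}"
    define N where "N = n * n"
    have "finite S" using finite_subset[OF Q(2)] by (simp add: finite_mats_over)
    then have "real (card ?T) \<le> (real_of_int (2 * k + 2 * Q) / real_of_int Q) ^ N * real (card S)"
      unfolding N_def using Q k
      by (intro card_box_le) (auto simp: bounded_int_mats_eq k_def mats_over_def)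
    also have "\<dots> \<le> (real_of_int (2 * k + 2 * Q) / real_of_int Q) ^ N * ((1 - c) ^ m * real_of_int Q ^ N)"
      using Q k by (intro mult_left_mono) (auto simp: N_def)
    also have "\<dots> = real_of_int (2 * k + 2 * Q) ^ N * (1 - c) ^ m"
      using Q(1) unfolding power_divide by simp
    also have "\<dots> \<le> real_of_int (2 * k + 2 * Q) ^ N * (\<epsilon> / 2)"
      using m k Q by (intro mult_left_mono) auto
    \<comment> \<open>As \<open>B \<le> 2 * k + 1\<close>, the excess \<open>2 * Q\<close> is at
      most \<open>(2 * k + 1) * (2 * Q / B)\<close>, so the side length \<open>2 * k + 1\<close>
      factors out.\<close>
    also have "\<dots> \<le> ((2 * k + 1) * (1 + 2 * Q / B)) ^ N * (\<epsilon> / 2)"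
    proof (intro mult_right_mono power_mono)
      have "1 \<le> (2 * k + 1) / B" using k elim by (simp add: field_simps)
      then have "real_of_int (2 * Q) * 1 \<le> real_of_int (2 * Q) * ((2 * k + 1) / B)"
        using Q by (intro mult_left_mono) auto
      then show "real_of_int (2 * k + 2 * Q) \<le> real_of_int (2 * k + 1) * (1 + real_of_int (2 * Q) / B)"
        by (simp add: algebra_simps add_divide_distrib)
    qed (use k Q \<epsilon> in auto)
    also have "\<dots> = (2 * k + 1) ^ N * ((1 + 2 * Q / B) ^ N * (\<epsilon> / 2))"
      by (simp add: power_mult_distrib)
    also have "\<dots> < (2 * k + 1) ^ N * (2 * (\<epsilon> / 2))"
      using elim \<epsilon> k by (intro mult_strict_left_mono mult_strict_right_mono) (auto simp: N_def)
    finally have "real (card ?T) < (2 * k + 1) ^ N * \<epsilon>" by simp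
    moreover have "real (card (bounded_int_mats n B)) = (2 * k + 1) ^ N"
      using k by (simp add: bounded_int_mats_eq card_mats_over k_def N_def)
    ultimately show ?case using k by (simp add: field_simps)
  qed
qed

section \<open>Irreducible polynomials modulo a prime\<close>

context poly_mod_prime
begin

text \<open>Canonical representatives of the monic polynomials of degree \<open>n\<close> over the
  field with \<open>p\<close> elements.\<close>

definition monics :: "nat \<Rightarrow> int poly set" where
  "monics n = {f. monic f \<and> degree f = n \<and> Mp f = f}"

text \<open>The test factors are monic because an integer representative could otherwise have a
  larger degree than its class modulo \<open>p\<close>; over a field this restriction loses
  nothing.\<close>

definition irr :: "int poly \<Rightarrow> bool" where
  "irr f \<longleftrightarrow> monic f \<and> degree f > 0 \<and> Mp f = f \<and>
     (\<forall>g h. monic g \<longrightarrow> monic h \<longrightarrow> f =m g * h \<longrightarrow> degree g = 0 \<or> degree h = 0)"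

definition irrs :: "nat \<Rightarrow> int poly set" where
  "irrs d = {f. irr f \<and> degree f = d}"

lemma irrD:
  assumes "irr f" "monic g" "monic h" "f =m g * h"
  shows "degree g = 0 \<or> degree h = 0"
proof -
  from assms(1) have "\<forall>g h. monic g \<longrightarrow> monic h \<longrightarrow> f =m g * h \<longrightarrow> degree g = 0 \<or> degree h = 0"
    unfolding irr_def by (elim conjE)
  then show ?thesis using assms(2-) by (elim allE impE)
qed

lemma monics_0: "monics 0 = {1}"
proof -
  have "f = 1" if "monic f" "degree f = 0" for f :: "int poly"
    using that by (metis monic_degree_0)
  then show ?thesis by (auto simp: monics_def)
qed

lemma monics_Suc: "monics (Suc n) = (\<lambda>(a, f). pCons a f) ` ({0..<p} \<times> monics n)"
proof (intro equalityI subsetI)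
  fix f assume f: "f \<in> monics (Suc n)"
  obtain a g where fg: "f = pCons a g" by (cases f) auto
  have "g \<noteq> 0" using f fg by (auto simp: monics_def)
  moreover have "\<forall>i. coeff f i \<in> {0..<p}" using f Mp_ident_iff by (auto simp: monics_def)
  then have "a \<in> {0..<p}" "\<forall>i. coeff g i \<in> {0..<p}"
    unfolding fg by (metis coeff_pCons_0, metis coeff_pCons_Suc)
  ultimately have "a \<in> {0..<p}" "g \<in> monics n"
    using f Mp_ident_iff[of g] unfolding fg by (auto simp: monics_def)
  then show "f \<in> (\<lambda>(a, f). pCons a f) ` ({0..<p} \<times> monics n)" using fg by auto
next
  fix f assume "f \<in> (\<lambda>(a, f). pCons a f) ` ({0..<p} \<times> monics n)"
  then obtain a g where g: "f = pCons a g" "a \<in> {0..<p}" "g \<in> monics n" by auto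
  have "g \<noteq> 0" using g by (auto simp: monics_def)
  moreover have "Mp f = f" using g Mp_ident_iff[of g] Mp_ident_iff[of f]
    by (auto simp: monics_def coeff_pCons split: nat.splits)
  ultimately show "f \<in> monics (Suc n)" using g by (auto simp: monics_def)
qed

lemma card_monics: "finite (monics n) \<and> card (monics n) = nat p ^ n"
proof (induction n)
  case (Suc n)
  have "inj_on (\<lambda>(a, f). pCons a f) ({0..<p} \<times> monics n)" by (auto simp: inj_on_def)
  then show ?case using Suc by (simp add: monics_Suc card_image card_cartesian_product)
qed (simp add: monics_0)

section \<open>Divisibility by monic polynomials modulo p\<close>

lemma monic_mult_m:
  assumes a: "monic a" and h: "Mp h = h" "h \<noteq> 0"
  shows "degree (Mp (a * h)) = degree a + degree h" "lead_coeff (Mp (a * h)) = lead_coeff h"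
proof -
  have a0: "a \<noteq> 0" using a by auto
  \<comment> \<open>The top coefficient of \<open>a * h\<close> is that of \<open>h\<close>, already
    reduced and nonzero, so \<open>Mp\<close> preserves it.\<close>
  have lc: "coeff (Mp (a * h)) (degree a + degree h) = lead_coeff h"
    using a h(1) Mp_coeff[of h "degree h"] by (simp add: Mp_coeff coeff_mult_degree_sum)
  have "degree (Mp (a * h)) \<le> degree a + degree h"
    using degree_m_le[of "a * h"] a0 h(2) by (simp add: degree_mult_eq)
  moreover have "degree a + degree h \<le> degree (Mp (a * h))"
    using lc h(2) by (intro le_degree) auto
  ultimately show "degree (Mp (a * h)) = degree a + degree h" by simp
  with lc show "lead_coeff (Mp (a * h)) = lead_coeff h" by simp
qed

lemma monic_dvdm_obtain:
  assumes "monic a" "monic f" "a dvdm f"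
  obtains h where "h \<in> monics (degree f - degree a)" "f =m a * h" "degree a \<le> degree f"
proof -
  obtain h where h: "f =m a * h" "Mp h = h" using assms(3) by (rule dvdmE)
  have "Mp f \<noteq> 0" using monic_Mp[OF assms(2)] by auto
  then have "h \<noteq> 0" using h by auto
  note mm = monic_mult_m[OF assms(1) h(2) this]
  show ?thesis using mm h assms monic_degree_m[OF assms(2)] monic_Mp[OF assms(2)]
    by (intro that[of h]) (auto simp: monics_def)
qed

lemma dvdm_degree_le: "monic a \<Longrightarrow> monic f \<Longrightarrow> a dvdm f \<Longrightarrow> degree a \<le> degree f"
  by (erule (2) monic_dvdm_obtain)

text \<open>If \<open>Mp (g - h)\<close> were nonzero, its product with the monic \<open>a\<close>
  would keep the same nonzero leading coefficient.\<close>

lemma monic_mult_cancel_m: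
  assumes "monic a" "a * g =m a * h"
  shows "g =m h"
proof (rule ccontr)
  assume neq: "\<not> g =m h"
  have "Mp (g - h) \<noteq> 0"
  proof
    assume "Mp (g - h) = 0"
    then have "Mp (g - h + h) = Mp (0 + h)" by (metis plus_Mp(1))
    then show False using neq by simp
  qed
  from monic_mult_m(2)[OF assms(1) _ this]
  have "lead_coeff (Mp (a * (g - h))) = lead_coeff (Mp (g - h))" by simp
  then have "Mp (a * (g - h)) \<noteq> 0" using \<open>Mp (g - h) \<noteq> 0\<close> by auto
  moreover have "Mp (a * (g - h)) = Mp (Mp (a * g) - Mp (a * h))" by (simp add: algebra_simps)
  ultimately show False using assms(2) by simp
qed

lemma monic_multiples_bij:
  assumes "monic a" "degree a \<le> n"
  shows "bij_betw (\<lambda>h. Mp (a * h)) (monics (n - degree a)) {f \<in> monics n. a dvdm f}"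
  unfolding bij_betw_def
proof
  show "inj_on (\<lambda>h. Mp (a * h)) (monics (n - degree a))"
  proof (rule inj_onI)
    fix g h assume "g \<in> monics (n - degree a)" "h \<in> monics (n - degree a)" "a * g =m a * h"
    then show "g = h" using monic_mult_cancel_m[OF assms(1), of g h] by (simp add: monics_def)
  qed
  show "(\<lambda>h. Mp (a * h)) ` monics (n - degree a) = {f \<in> monics n. a dvdm f}"
  proof (intro equalityI subsetI)
    fix f assume "f \<in> (\<lambda>h. Mp (a * h)) ` monics (n - degree a)"
    then obtain h where h: "f = Mp (a * h)" "monic h" "degree h = n - degree a" "Mp h = h"
      by (auto simp: monics_def)
    have "h \<noteq> 0" using h by auto
    with h show "f \<in> {f \<in> monics n. a dvdm f}" using monic_mult_m[OF assms(1) h(4)] assms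
      by (auto simp: monics_def dvdm_def)
  next
    fix f assume "f \<in> {f \<in> monics n. a dvdm f}"
    then have f: "monic f" "degree f = n" "Mp f = f" "a dvdm f" by (auto simp: monics_def)
    obtain h where h: "h \<in> monics (degree f - degree a)" "f =m a * h"
      using monic_dvdm_obtain[OF assms(1) f(1,4)] .
    show "f \<in> (\<lambda>h. Mp (a * h)) ` monics (n - degree a)"
      by (rule image_eqI[of _ _ h]) (use h f(2,3) in simp_all)
  qed
qed

lemma card_monic_multiples:
  assumes "monic a"
  shows "card {f \<in> monics n. a dvdm f} = (if degree a \<le> n then nat p ^ (n - degree a) else 0)"
proof (cases "degree a \<le> n")
  case True
  then show ?thesis using bij_betw_same_card[OF monic_multiples_bij[OF assms]] card_monics by simp
next
  case False
  then have "{f \<in> monics n. a dvdm f} = {}" using dvdm_degree_le[OF assms] by (auto simp: monics_def)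
  then show ?thesis using False by (metis card.empty)
qed

section \<open>Bezout and unique factorisation modulo p\<close>

lemma irr_bezout:
  assumes P: "irr P" and R: "irr R" and neq: "P \<noteq> R"
  obtains u v where "u * P + v * R =m 1"
proof -
  \<comment> \<open>\<open>I\<close> singles out the monic elements of the ideal generated by
    \<open>P\<close> and \<open>R\<close> modulo \<open>p\<close>. One of least degree divides the
    whole ideal, and distinct irreducibles force it to be 1.\<close>
  define I where "I g \<longleftrightarrow> monic g \<and> (\<exists>u v. u * P + v * R =m g)" for g
  have "I P" using P unfolding I_def irr_def by (metis add.right_neutral mult_1 mult_zero_left)
  then obtain g where g: "I g" and min: "\<And>g'. I g' \<Longrightarrow> degree g \<le> degree g'"
    using ex_has_least_nat[of I P degree] by blast
  obtain u v where uv: "u * P + v * R =m g" and mg: "monic g" using g by (auto simp: I_def)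
  have dvd: "g dvdm s * P + t * R" for s t
  proof -
    define x where "x = s * P + t * R"
    \<comment> \<open>Since \<open>g\<close> is monic, the multiplier of the pseudo-division is 1:
      this is true division with remainder over the integers.\<close>
    obtain q r where qr: "pseudo_divmod x g = (q, r)" by force
    have g0: "g \<noteq> 0" using mg by auto
    from pseudo_divmod[OF g0 qr] mg have xr: "x = g * q + r" "r = 0 \<or> degree r < degree g" by auto
    have "Mp r = 0"
    proof (rule ccontr)
      assume r0: "Mp r \<noteq> 0"
      define c where "c = lead_coeff (Mp r)"
      have "c \<noteq> 0" using r0 by (simp add: c_def)
      moreover have "M c = c" unfolding c_def by (metis Mp_Mp Mp_coeff)
      ultimately have "\<not> p dvd c" by (auto simp: M_def)
      then have "algebraic_semidom_class.coprime p c" using prime by (rule prime_imp_coprime[rotated])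
      then have "gcd p c = 1" by simp
      then obtain w e where "w * p + e * c = 1" using bezout_int[of p c] by auto
      then have "(e * c + w * p) mod p = 1 mod p" by (simp add: add.commute)
      then have e: "M (e * c) = 1" using M_1 by (simp add: M_def)
      \<comment> \<open>\<open>e\<close> inverts the leading coefficient of the remainder modulo
        \<open>p\<close>, so \<open>g'\<close> is the remainder made monic: an element of the ideal
        of degree below that of \<open>g\<close>.\<close>
      define g' where "g' = Mp (Polynomial.smult e (Mp r))"
      have lc: "coeff g' (degree (Mp r)) = 1" using e by (simp add: g'_def Mp_coeff c_def)
      have "degree g' \<le> degree (Mp r)" unfolding g'_def
        by (metis degree_m_le degree_smult_le le_trans)
      then have deg: "degree g' = degree (Mp r)" by (rule antisym) (use lc in \<open>simp add: le_degree\<close>)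
      have r: "r = x - g * q" using xr(1) by simp
      have "Mp g' = Mp (Polynomial.smult e r)" by (simp only: g'_def Mp_Mp Mp_smult)
      also have "\<dots> = Mp (Polynomial.smult e (Mp (x - Mp (Mp g * q))))"
        by (simp only: r Mp_smult minus_Mp mult_Mp)
      also have "\<dots> = Mp (Polynomial.smult e (Mp (x - Mp (Mp (u * P + v * R) * q))))"
        by (simp only: uv)
      also have "\<dots> = Mp (Polynomial.smult e (x - (u * P + v * R) * q))"
        by (simp only: Mp_smult minus_Mp mult_Mp)
      also have "Polynomial.smult e (x - (u * P + v * R) * q) =
        (Polynomial.smult e (s - u * q)) * P + (Polynomial.smult e (t - v * q)) * R"
        unfolding x_def by (simp add: Polynomial.smult_diff_right Polynomial.smult_add_right algebra_simps)
      finally have "\<exists>u v. u * P + v * R =m g'" by (intro exI) (rule sym)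
      then have "I g'" unfolding I_def using lc deg by simp
      then have "degree g \<le> degree (Mp r)" using min deg by fastforce
      then show False using xr(2) degree_m_le[of r] r0 by auto
    qed
    then have "x =m g * q" using xr(1) by (metis add.right_neutral plus_Mp(2))
    then show ?thesis unfolding dvdm_def x_def by blast
  qed
  have "g dvdm P" "g dvdm R" using dvd[of 1 0] dvd[of 0 1] by auto
  have *: "degree g = 0 \<or> g =m X" if X: "irr X" "g dvdm X" for X
  proof -
    have mX: "monic X" using X by (simp add: irr_def)
    obtain h where h: "h \<in> monics (degree X - degree g)" "X =m g * h"
      using monic_dvdm_obtain[OF mg mX X(2)] .
    have "monic h" using h unfolding monics_def by blast
    with irrD[OF X(1) mg] h(2) have "degree g = 0 \<or> degree h = 0" by simp
    moreover have "h = 1" if "degree h = 0" using \<open>monic h\<close> that by (metis monic_degree_0)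
    ultimately show ?thesis using h(2) by fastforce
  qed
  have "degree g = 0"
  proof (rule ccontr)
    assume "degree g \<noteq> 0"
    then have "g =m P" "g =m R" using *[OF P \<open>g dvdm P\<close>] *[OF R \<open>g dvdm R\<close>] by metis+
    then have "Mp P = Mp R" by simp
    moreover have "Mp P = P" "Mp R = R" using P R unfolding irr_def by blast+
    ultimately show False using neq by simp
  qed
  then have "g = 1" using mg by (metis monic_degree_0)
  then show ?thesis using uv that by auto
qed

text \<open>Euclid's lemma for powers, peeling off one \<open>P\<close> at a time: after cancelling
  \<open>P ^ k\<close>, Bezout turns divisibility of \<open>R * h'\<close> by \<open>P\<close> into
  divisibility of \<open>h'\<close> by \<open>P\<close>.\<close>

lemma irr_power_dvdm_mult:
  assumes P: "irr P" and R: "irr R" and neq: "P \<noteq> R" and "P ^ k dvdm R * h"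
  shows "P ^ k dvdm h"
  using assms(4)
proof (induction k)
  case 0
  show ?case by (auto simp: dvdm_def)
next
  case (Suc k)
  obtain w where w: "R * h =m P ^ Suc k * w" using Suc.prems by (auto simp: dvdm_def)
  then have "P ^ k dvdm R * h" by (auto simp: dvdm_def mult_ac intro!: exI[of _ "P * w"])
  from Suc.IH[OF this] obtain h' where h': "h =m P ^ k * h'" by (auto simp: dvdm_def)
  have mP: "monic (P ^ k)" using P by (simp add: irr_def monic_power)
  have "P ^ k * (R * h') =m R * Mp (P ^ k * h')" by (simp add: mult_ac)
  also have "Mp (R * Mp (P ^ k * h')) = Mp (R * h)" unfolding h'[symmetric] by simp
  also have "\<dots> = Mp (P ^ k * (P * w))" unfolding w by (simp add: mult_ac)
  finally have RP: "R * h' =m P * w" by (rule monic_mult_cancel_m[OF mP])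
  obtain u v where uv: "u * P + v * R =m 1" using irr_bezout[OF P R neq] .
  have "Mp h' = Mp (Mp 1 * h')" by simp
  also have "\<dots> = Mp (Mp (u * P + v * R) * h')" unfolding uv by simp
  also have "\<dots> = Mp (u * P * h' + v * (R * h'))" by (simp add: algebra_simps)
  also have "\<dots> = Mp (u * P * h' + Mp (v * Mp (R * h')))" by simp
  also have "\<dots> = Mp (u * P * h' + v * (P * w))" unfolding RP by simp
  finally have eq: "h' =m P * (u * h' + v * w)" by (simp add: algebra_simps)
  have "Mp h = Mp (P ^ k * Mp h')" using h' by simp
  also have "\<dots> = Mp (P ^ Suc k * (u * h' + v * w))" unfolding eq by (simp add: mult_ac)
  finally show ?case unfolding dvdm_def by blast
qed

text \<open>For irreducible \<open>P\<close> and monic \<open>f\<close> this is the interval from 1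
  to the exponent of \<open>P\<close> in \<open>f\<close>, so its cardinality is the
  \<open>P\<close>-adic valuation, in a form suited to double counting.\<close>

definition mult_irr :: "int poly \<Rightarrow> int poly \<Rightarrow> nat set" where
  "mult_irr P f = {k. k \<ge> 1 \<and> P ^ k dvdm f}"

lemma mult_irr_subset:
  assumes "irr P" "monic f"
  shows "mult_irr P f \<subseteq> {1..degree f}"
proof
  fix k assume k: "k \<in> mult_irr P f"
  have "degree (P ^ k) \<le> degree f"
    using k assms by (intro dvdm_degree_le) (auto simp: mult_irr_def irr_def monic_power)
  moreover have "P \<noteq> 0" using assms by (auto simp: irr_def)
  then have "degree (P ^ k) = k * degree P" by (simp add: degree_power_eq mult.commute)
  moreover have "k \<le> k * degree P" using assms by (simp add: irr_def)
  ultimately have "k \<le> degree f" by linarith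
  then show "k \<in> {1..degree f}" using k unfolding mult_irr_def by simp
qed

lemma mult_irr_mult:
  assumes P: "irr P" and R: "irr R" and f: "f =m R * h" and h: "monic h"
  shows "card (mult_irr P f) = card (mult_irr P h) + (if P = R then 1 else 0)"
proof (cases "P = R")
  case False
  have "P ^ k dvdm f \<longleftrightarrow> P ^ k dvdm h" for k
  proof
    assume "P ^ k dvdm f"
    then have "P ^ k dvdm R * h" using f by (simp add: dvdm_def)
    then show "P ^ k dvdm h" using irr_power_dvdm_mult[OF P R False] by blast
  next
    assume "P ^ k dvdm h"
    then have "P ^ k dvdm h * R" by (rule dvdm_factor)
    then show "P ^ k dvdm f" using f by (simp add: dvdm_def mult.commute)
  qed
  then show ?thesis using False by (simp add: mult_irr_def)
next
  case True
  have mP: "monic P" using P by (simp add: irr_def)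
  have *: "P ^ Suc k dvdm f \<longleftrightarrow> P ^ k dvdm h" for k
  proof
    assume "P ^ Suc k dvdm f"
    then obtain w where "P * h =m P * (P ^ k * w)" using f True by (auto simp: dvdm_def mult_ac)
    then have "h =m P ^ k * w" by (rule monic_mult_cancel_m[OF mP])
    then show "P ^ k dvdm h" unfolding dvdm_def by blast
  next
    assume "P ^ k dvdm h"
    then obtain w where w: "h =m P ^ k * w" by (auto simp: dvdm_def)
    have "Mp f = Mp (P * Mp h)" using f True by simp
    also have "\<dots> = Mp (P ^ Suc k * w)" unfolding w by (simp add: mult_ac)
    finally show "P ^ Suc k dvdm f" by (auto simp: dvdm_def)
  qed
  have "mult_irr P f = insert 1 (Suc ` mult_irr P h)"
  proof (intro equalityI subsetI)
    fix k assume k: "k \<in> mult_irr P f"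
    then obtain j where "k = Suc j" by (cases k) (auto simp: mult_irr_def)
    then show "k \<in> insert 1 (Suc ` mult_irr P h)" using k * by (cases "j = 0") (auto simp: mult_irr_def)
  next
    fix k assume "k \<in> insert 1 (Suc ` mult_irr P h)"
    moreover have "P ^ 0 dvdm h" by (auto simp: dvdm_def)
    ultimately obtain j where "k = Suc j" "P ^ j dvdm h" by (auto simp: mult_irr_def)
    then show "k \<in> mult_irr P f" using *[of j] unfolding mult_irr_def by simp
  qed
  moreover have "finite (mult_irr P h)" using mult_irr_subset[OF P h] finite_subset by blast
  moreover have "1 \<notin> Suc ` mult_irr P h" by (auto simp: mult_irr_def)
  ultimately show ?thesis using True by (simp add: card_image)
qed

text \<open>A nonconstant monic divisor of least degree is irreducible, since a proper factor of it
  would be a smaller such divisor.\<close>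

lemma irr_factor_exists:
  assumes "monic f" "degree f > 0"
  obtains R h where "irr R" "monic h" "Mp h = h" "f =m R * h" "degree f = degree R + degree h"
proof -
  define D where "D R \<longleftrightarrow> monic R \<and> Mp R = R \<and> degree R > 0 \<and> R dvdm f" for R
  have "D (Mp f)" using assms monic_Mp by (auto simp: D_def dvdm_def intro!: exI[of _ 1])
  then obtain R where R: "D R" and min: "\<And>R'. D R' \<Longrightarrow> degree R \<le> degree R'"
    using ex_has_least_nat[of D "Mp f" degree] by blast
  have "irr R" unfolding irr_def
  proof (intro conjI allI impI)
    fix g h assume gh: "monic g" "monic h" "R =m g * h"
    have g0: "h \<noteq> 0" using gh by auto
    have deg: "degree R = degree g + degree h"
      using gh R by (metis D_def degree_mult_eq monic_degree_m monic_mult leading_coeff_0_iff zero_neq_one)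
    obtain w where w: "f =m R * w" using R by (auto simp: D_def dvdm_def)
    have "Mp f = Mp (Mp R * w)" using w by simp
    also have "\<dots> = Mp (g * (h * w))" unfolding gh(3) by (simp add: mult.assoc)
    also have "\<dots> = Mp (Mp g * (h * w))" by simp
    finally have "D (Mp g)" if "degree g > 0"
      using that gh monic_Mp[of g] by (auto simp: D_def dvdm_def)
    then show "degree g = 0 \<or> degree h = 0" using min[of "Mp g"] deg gh by fastforce
  qed (use R in \<open>auto simp: D_def\<close>)
  have "monic R" "R dvdm f" using R unfolding D_def by blast+
  then obtain h where h: "h \<in> monics (degree f - degree R)" "f =m R * h" "degree R \<le> degree f"
    using monic_dvdm_obtain[OF _ assms(1)] by blast
  then have "monic h" "degree h = degree f - degree R" "Mp h = h" unfolding monics_def by blast+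
  then show ?thesis using h by (intro that[OF \<open>irr R\<close>, of h]) simp_all
qed

lemma finite_irrs: "finite (irrs d)"
  by (rule finite_subset[of _ "monics d"]) (use card_monics in \<open>auto simp: irrs_def irr_def monics_def\<close>)

text \<open>Splitting off an irreducible factor \<open>R\<close> lowers both sides by
  \<open>degree R\<close>. The bound \<open>N\<close> is kept apart from the degree so that the
  summation range stays fixed along the induction.\<close>

lemma degree_eq_sum_mult_irr:
  assumes "monic f" "degree f \<le> N"
  shows "degree f = (\<Sum>d=1..N. \<Sum>P\<in>irrs d. d * card (mult_irr P f))"
  using assms
proof (induction "degree f" arbitrary: f rule: less_induct)
  case less
  show ?case
  proof (cases "degree f = 0")
    case True
    have "mult_irr P f = {}" if "irr P" for P
      using mult_irr_subset[OF that less.prems(1)] True by auto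
    then show ?thesis using True by (auto simp: irrs_def)
  next
    case False
    then obtain R h where R: "irr R" "monic h" "f =m R * h" "degree f = degree R + degree h"
      using irr_factor_exists less.prems by (metis neq0_conv)
    have dR: "degree R > 0" using R by (simp add: irr_def)
    have "degree h = (\<Sum>d=1..N. \<Sum>P\<in>irrs d. d * card (mult_irr P h))"
      using R dR less.prems by (intro less.hyps) auto
    moreover have "degree R = (\<Sum>d=1..N. \<Sum>P\<in>irrs d. if P = R then d else 0)"
    proof -
      have "(\<Sum>P\<in>irrs d. if P = R then d else 0) = (if d = degree R then d else 0)" for d
        using finite_irrs[of d] R(1) by (auto simp: irrs_def)
      then show ?thesis using dR less.prems R(4) by simp
    qed
    ultimately have "degree f = (\<Sum>d=1..N. \<Sum>P\<in>irrs d. d * card (mult_irr P h) + (if P = R then d else 0))"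
      using R(4) by (simp add: sum.distrib)
    also have "\<dots> = (\<Sum>d=1..N. \<Sum>P\<in>irrs d. d * card (mult_irr P f))"
      using mult_irr_mult[OF _ R(1,3,2)] by (intro sum.cong refl) (auto simp: irrs_def)
    finally show ?thesis .
  qed
qed

text \<open>Double counting: unique factorisation gives each monic f of degree n as the sum of the degrees
  of the irreducible P over all k with P^k dividing f, and P^k divides p^{n - k deg P} of them.\<close>

lemma sum_multiples:
  "(\<Sum>d=1..n. \<Sum>k=1..n. if k * d \<le> n then d * card (irrs d) * nat p ^ (n - k * d) else 0) = n * nat p ^ n"
proof -
  have fin: "finite (monics n)" using card_monics by auto
  have "n * nat p ^ n = (\<Sum>f\<in>monics n. degree f)"
    using card_monics by (simp add: monics_def)
  also have "\<dots> = (\<Sum>f\<in>monics n. \<Sum>d=1..n. \<Sum>P\<in>irrs d. \<Sum>k=1..n. if P ^ k dvdm f then d else 0)"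
  proof (intro sum.cong refl)
    fix f assume f: "f \<in> monics n"
    have "d * card (mult_irr P f) = (\<Sum>k=1..n. if P ^ k dvdm f then d else 0)" if "P \<in> irrs d" for d P
    proof -
      have "mult_irr P f \<subseteq> {1..n}" using that f mult_irr_subset[of P f] by (auto simp: irrs_def monics_def)
      then have "mult_irr P f = {k \<in> {1..n}. P ^ k dvdm f}" by (auto simp: mult_irr_def)
      then show ?thesis by (simp add: sum.If_cases Int_def)
    qed
    then show "degree f = (\<Sum>d=1..n. \<Sum>P\<in>irrs d. \<Sum>k=1..n. if P ^ k dvdm f then d else 0)"
      using degree_eq_sum_mult_irr[of f n] f by (auto simp: monics_def)
  qed
  also have "\<dots> = (\<Sum>d=1..n. \<Sum>P\<in>irrs d. \<Sum>k=1..n. \<Sum>f\<in>monics n. if P ^ k dvdm f then d else 0)"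
    unfolding sum.swap[of _ _ "monics n"] ..
  also have "\<dots> = (\<Sum>d=1..n. \<Sum>P\<in>irrs d. \<Sum>k=1..n. if k * d \<le> n then d * nat p ^ (n - k * d) else 0)"
  proof (intro sum.cong refl)
    fix d P k assume P: "P \<in> irrs d"
    have "P \<noteq> 0" using P by (auto simp: irrs_def irr_def)
    then have "degree (P ^ k) = k * d" using P by (auto simp: irrs_def degree_power_eq mult.commute)
    moreover have "monic (P ^ k)" using P by (intro monic_power) (auto simp: irrs_def irr_def)
    ultimately have m: "degree (P ^ k) = k * d" "monic (P ^ k)" by blast+
    have "(\<Sum>f\<in>monics n. if P ^ k dvdm f then d else 0) = d * card {f \<in> monics n. P ^ k dvdm f}"
      using fin by (simp add: sum.If_cases Int_def)
    then show "(\<Sum>f\<in>monics n. if P ^ k dvdm f then d else 0) = (if k * d \<le> n then d * nat p ^ (n - k * d) else 0)"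
      unfolding card_monic_multiples[OF m(2)] m(1) by simp
  qed
  also have "\<dots> = (\<Sum>d=1..n. \<Sum>k=1..n. if k * d \<le> n then d * card (irrs d) * nat p ^ (n - k * d) else 0)"
  proof (rule sum.cong[OF refl])
    fix d
    show "(\<Sum>P\<in>irrs d. \<Sum>k=1..n. if k * d \<le> n then d * nat p ^ (n - k * d) else 0) =
      (\<Sum>k=1..n. if k * d \<le> n then d * card (irrs d) * nat p ^ (n - k * d) else 0)"
      by (subst sum.swap, rule sum.cong[OF refl]) simp
  qed
  finally show ?thesis by simp
qed

text \<open>Gauss' formula, obtained by subtracting p times the previous identity for n - 1.\<close>

lemma necklace_identity:
  assumes "n \<ge> 1"
  shows "(\<Sum>d=1..n. \<Sum>k=1..n. if k * d = n then d * card (irrs d) else 0) = nat p ^ n"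
proof -
  define E where "E N n = (\<Sum>d=1..N. \<Sum>k=1..N. if k * d \<le> n then d * card (irrs d) * nat p ^ (n - k * d) else 0)" for N n
  obtain m where m: "n = Suc m" using assms by (cases n) auto
  \<comment> \<open>Enlarging the ranges to \<open>n\<close> adds only pairs with
    \<open>k * d > m\<close>, whose terms vanish.\<close>
  have "E n m = E m m"
    unfolding E_def
  proof (rule sum.mono_neutral_cong_right)
    have "m < k * d" if "d \<in> {1..n} - {1..m}" "k \<in> {1..n}" for k d
    proof -
      have "1 * n \<le> k * d" using that m by (intro mult_le_mono) auto
      then show ?thesis using m by simp
    qed
    then show "\<forall>d\<in>{1..n} - {1..m}. (\<Sum>k=1..n. if k * d \<le> m then d * card (irrs d) * nat p ^ (m - k * d) else 0) = 0"
      by (intro ballI sum.neutral) (metis not_le)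
    fix d assume d: "d \<in> {1..m}"
    have "\<not> k * d \<le> m" if "k \<in> {1..n} - {1..m}" for k
    proof -
      have "n * 1 \<le> k * d" using that d m by (intro mult_le_mono) auto
      then show ?thesis using m by simp
    qed
    then have "\<forall>k\<in>{1..n} - {1..m}. (if k * d \<le> m then d * card (irrs d) * nat p ^ (m - k * d) else 0) = 0"
      by simp
    then show "(\<Sum>k=1..n. if k * d \<le> m then d * card (irrs d) * nat p ^ (m - k * d) else 0) =
      (\<Sum>k=1..m. if k * d \<le> m then d * card (irrs d) * nat p ^ (m - k * d) else 0)"
      by (intro sum.mono_neutral_right) (auto simp: m)
  qed (auto simp: m)
  then have E: "E n m = m * nat p ^ m" "E n n = n * nat p ^ n"
    using sum_multiples unfolding E_def by simp_all
  \<comment> \<open>Multiplying by \<open>p\<close> matches every term with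
    \<open>k * d \<le> m\<close>; what remains are the pairs with \<open>k * d = n\<close>, where
    the power of \<open>p\<close> is 1.\<close>
  have "E n n = nat p * E n m + (\<Sum>d=1..n. \<Sum>k=1..n. if k * d = n then d * card (irrs d) else 0)"
    unfolding E_def sum_distrib_left sum.distrib[symmetric]
  proof (intro sum.cong refl)
    fix d k
    consider "k * d \<le> m" | "k * d = n" | "k * d > n" unfolding m by linarith
    then show "(if k * d \<le> n then d * card (irrs d) * nat p ^ (n - k * d) else 0) =
       nat p * (if k * d \<le> m then d * card (irrs d) * nat p ^ (m - k * d) else 0) +
       (if k * d = n then d * card (irrs d) else 0)"
    proof cases
      case 1
      then have "n - k * d = Suc (m - k * d)" by (simp add: m Suc_diff_le)
      then show ?thesis using 1 by (simp add: m)
    qed (simp_all add: m)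
  qed
  then show ?thesis using E by (simp add: m)
qed

lemma irrs_upper: "d \<ge> 1 \<Longrightarrow> d * card (irrs d) \<le> nat p ^ d"
proof -
  assume d: "d \<ge> 1"
  have "d * card (irrs d) = (\<Sum>e\<in>{d}. \<Sum>k\<in>{1}. if k * e = d then e * card (irrs e) else 0)" by simp
  also have "\<dots> \<le> (\<Sum>e\<in>{d}. \<Sum>k=1..d. if k * e = d then e * card (irrs e) else 0)"
    using d by (intro sum_mono sum_mono2) auto
  also have "\<dots> \<le> (\<Sum>e=1..d. \<Sum>k=1..d. if k * e = d then e * card (irrs e) else 0)"
    using d by (intro sum_mono2) auto
  finally show ?thesis using necklace_identity[OF d] by simp
qed

text \<open>In Gauss' formula each proper divisor \<open>d\<close> contributes at most
  \<open>p ^ d\<close>. Bounding by all \<open>d < n\<close> gives a geometric sum, at most half of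
  \<open>p ^ n\<close> once \<open>p \<ge> 3\<close>; the other half must come from degree
  \<open>n\<close>.\<close>

lemma irrs_lower:
  assumes "n \<ge> 1" "p \<ge> 3"
  shows "nat p ^ n \<le> 2 * n * card (irrs n)"
proof -
  define q where "q = nat p"
  have q: "q \<ge> 3" using assms by (simp add: q_def)
  have inner: "(\<Sum>k=1..n. if k * d = n then d * card (irrs d) else 0) \<le> d * card (irrs d)" if "d \<ge> 1" for d
  proof -
    have "{k \<in> {1..n}. k * d = n} \<subseteq> {n div d}" using that by auto
    then have "card {k \<in> {1..n}. k * d = n} \<le> 1" by (metis card_mono card.empty card_insert_disjoint empty_iff finite.intros One_nat_def)
    then have "card {k \<in> {1..n}. k * d = n} * (d * card (irrs d)) \<le> 1 * (d * card (irrs d))"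
      by (rule mult_right_mono) simp
    then show ?thesis by (simp add: sum.If_cases Int_def)
  qed
  obtain m where m: "n = Suc m" using assms by (cases n) auto
  have geo: "2 * (\<Sum>d=1..m. q ^ d) \<le> q * q ^ m" for m
  proof (induction m)
    case (Suc m)
    have "2 * (\<Sum>d=1..Suc m. q ^ d) \<le> q * q ^ m + 2 * q ^ Suc m" using Suc by simp
    also have "\<dots> = 3 * q ^ Suc m" by simp
    also have "\<dots> \<le> q * q ^ Suc m" using q by (intro mult_right_mono) auto
    finally show ?case .
  qed (use q in simp)
  have "q ^ n \<le> (\<Sum>d=1..n. d * card (irrs d))"
    unfolding q_def necklace_identity[OF assms(1), symmetric] by (intro sum_mono inner) auto
  also have "\<dots> = (\<Sum>d=1..m. d * card (irrs d)) + n * card (irrs n)" by (simp add: m)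
  also have "\<dots> \<le> (\<Sum>d=1..m. q ^ d) + n * card (irrs n)"
    unfolding q_def by (intro add_right_mono sum_mono irrs_upper) auto
  finally show ?thesis using geo[of m] by (simp add: q_def m)
qed

text \<open>The leading coefficients of two integer factors of \<open>f\<close> are both 1 or both
  -1, so up to sign the factors are monic, and a monic factor of degree 0 is 1.\<close>

lemma irreducible_if_irr_m:
  fixes f :: "int poly"
  assumes f: "monic f" "degree f > 0" and irr: "irr (Mp f)"
  shows "irreducible f"
proof (rule irreducibleI)
  show "f \<noteq> 0" using f by auto
  show "\<not> f dvd 1" using f by (auto simp: poly_dvd_1)
  fix a b assume ab: "f = a * b"
  have key: "a dvd 1 \<or> b dvd 1" if ab: "f = a * b" and m: "monic a" "monic b" for a b
  proof -
    have "degree a = 0 \<or> degree b = 0" using irr ab m by (auto simp: irr_def)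
    then show ?thesis using m by (metis monic_degree_0 dvd_refl)
  qed
  have "lead_coeff a * lead_coeff b = 1" using f ab by (metis lead_coeff_mult)
  then have "lead_coeff a = 1 \<and> lead_coeff b = 1 \<or> lead_coeff a = -1 \<and> lead_coeff b = -1"
    by (metis pos_zmult_eq_1_iff_lemma zmult_eq_1_iff)
  then show "a dvd 1 \<or> b dvd 1"
    using key[of a b] key[of "-a" "-b"] ab by auto
qed

end

section \<open>Companion matrices and their conjugates\<close>

text \<open>With the coefficients in the last column, right multiplication by
  \<open>companion f\<close> shifts the columns of a matrix, as a Krylov basis requires.\<close>

definition companion :: "int poly \<Rightarrow> int mat" where
  "companion f = mat (degree f) (degree f)
     (\<lambda>(i, j). if Suc j = degree f then - coeff f i else if i = Suc j then 1 else 0)"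

lemma companion_carrier: "companion f \<in> carrier_mat (degree f) (degree f)"
  by (simp add: companion_def)

text \<open>Expansion along the first row has two terms: \<open>X\<close> times the characteristic
  polynomial for \<open>g\<close>, and the constant coefficient \<open>a\<close> times a triangular
  minor with diagonal -1, whose sign cancels that of its position.\<close>

lemma char_poly_companion:
  assumes "monic f" "degree f > 0"
  shows "char_poly (companion f) = f"
  using assms
proof (induction f)
  case (pCons a g)
  have g0: "g \<noteq> 0" using pCons.prems by auto
  have mg: "monic g" using pCons.prems g0 by simp
  define n where "n = degree g"
  have deg: "degree (pCons a g) = Suc n" using g0 by (simp add: n_def)
  define A where "A = char_poly_matrix (companion (pCons a g))"
  have A: "A \<in> carrier_mat (Suc n) (Suc n)"
    unfolding A_def using companion_carrier[of "pCons a g"] deg by (metis char_poly_matrix_closed)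
  have A_nth: "A $$ (i, j) = (if i = j then [:0, 1:] else 0) +
      (if j = n then [:coeff (pCons a g) i:] else if i = Suc j then [:-1:] else 0)"
    if "i < Suc n" "j < Suc n" for i j
    using that deg by (simp add: A_def char_poly_matrix_def companion_def)
  show ?case
  \<comment> \<open>For \<open>n = 0\<close> the first and last columns coincide, so the two terms
    share one entry.\<close>
  proof (cases "n = 0")
    case True
    then have "g = 1" using mg by (metis monic_degree_0 n_def)
    have "det A = A $$ (0, 0)" using A True by (intro det_single) auto
    also have "\<dots> = pCons a g" using A_nth[of 0 0] True \<open>g = 1\<close> by simp
    finally show ?thesis by (simp add: A_def char_poly_def)
  next
    case False
    have row0: "A $$ (0, j) = (if j = 0 then [:0, 1:] else if j = n then [:a:] else 0)" if "j < Suc n" for j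
      using that False A_nth[of 0 j] by auto
    have "det A = (\<Sum>j<Suc n. A $$ (0, j) * cofactor A 0 j)"
      by (rule laplace_expansion_row[OF A]) simp
    also have "\<dots> = (\<Sum>j\<in>{0, n}. A $$ (0, j) * cofactor A 0 j)"
      using row0 by (intro sum.mono_neutral_right) auto
    also have "\<dots> = [:0, 1:] * cofactor A 0 0 + [:a:] * cofactor A 0 n"
      using False row0 by simp
    also have "cofactor A 0 0 = g"
    proof -
      have "mat_delete A 0 0 = char_poly_matrix (companion g)"
      proof (rule eq_matI)
        fix i j assume "i < dim_row (char_poly_matrix (companion g))" "j < dim_col (char_poly_matrix (companion g))"
        then have ij: "i < n" "j < n" by (simp_all add: char_poly_matrix_def companion_def n_def)
        then have "mat_delete A 0 0 $$ (i, j) = A $$ (Suc i, Suc j)"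
          using A by (simp add: mat_delete_def)
        also have "\<dots> = (if i = j then [:0, 1:] else 0) +
            (if Suc j = n then [:coeff g i:] else if i = Suc j then [:-1:] else 0)"
          using ij A_nth[of "Suc i" "Suc j"] by simp
        also have "\<dots> = char_poly_matrix (companion g) $$ (i, j)"
          using ij by (simp add: char_poly_matrix_def companion_def n_def)
        finally show "mat_delete A 0 0 $$ (i, j) = char_poly_matrix (companion g) $$ (i, j)" .
      qed (use A in \<open>simp_all add: char_poly_matrix_def companion_def n_def\<close>)
      then show ?thesis using pCons.IH[OF mg] False by (simp add: cofactor_def char_poly_def n_def)
    qed
    also have "cofactor A 0 n = 1"
    proof -
      define D where "D = mat_delete A 0 n"
      have D: "D \<in> carrier_mat n n" using mat_delete_carrier[OF A] by (simp add: D_def)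
      have D_nth: "D $$ (i, j) = A $$ (Suc i, j)" if "i < n" "j < n" for i j
        using that A by (simp add: D_def mat_delete_def)
      have "upper_triangular D"
        using D by (auto simp: upper_triangular_def D_nth A_nth)
      then have "det D = prod_list (diag_mat D)" by (rule det_upper_triangular[OF _ D])
      also have "diag_mat D = map (\<lambda>i. [:-1:]) [0..<n]"
        unfolding diag_mat_def using D by (auto simp: D_nth A_nth)
      also have "prod_list \<dots> = [:-1:] ^ n" by (simp add: map_replicate_const)
      finally have "cofactor A 0 n = (- 1 * [:-1:]) ^ n"
        unfolding cofactor_def D_def power_mult_distrib by simp
      then show ?thesis by simp
    qed
    finally show ?thesis by (simp add: A_def char_poly_def)
  qed
qed simp

section \<open>Characteristic polynomials under conjugation modulo p\<close>

context poly_mod_prime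
begin

lemma det_cong_m:
  assumes "A \<in> carrier_mat n n" "B \<in> carrier_mat n n"
    and "\<And>i j. i < n \<Longrightarrow> j < n \<Longrightarrow> A $$ (i, j) =m B $$ (i, j)"
  shows "det A =m det B"
proof -
  have prod_cong: "prod f X =m prod g X" if "finite X" "\<And>x. x \<in> X \<Longrightarrow> f x =m g x"
    for f g :: "nat \<Rightarrow> int poly" and X
    using that by (induction X) (simp, metis finite_insert insertCI mult_Mp prod.insert)
  have sum_cong: "sum f X =m sum g X" if "finite X" "\<And>x. x \<in> X \<Longrightarrow> f x =m g x"
    for f g :: "(nat \<Rightarrow> nat) \<Rightarrow> int poly" and X
    using that by (induction X) (simp, metis finite_insert insertCI plus_Mp sum.insert)
  show ?thesis unfolding det_def'[OF assms(1)] det_def'[OF assms(2)]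
  proof (rule sum_cong)
    fix q assume "q \<in> {q. q permutes {0..<n}}"
    then have "\<And>i. i < n \<Longrightarrow> q i < n" using permutes_in_image[of q "{0..<n}"] by auto
    then have "(\<Prod>i = 0..<n. A $$ (i, q i)) =m (\<Prod>i = 0..<n. B $$ (i, q i))"
      using assms(3) by (intro prod_cong) auto
    then show "signof q * (\<Prod>i = 0..<n. A $$ (i, q i)) =m signof q * (\<Prod>i = 0..<n. B $$ (i, q i))"
      by (metis mult_Mp(2))
  qed (simp add: finite_permutations)
qed

lemma mat_mod_mult_left:
  assumes "A \<in> carrier_mat n m" "B \<in> carrier_mat m k"
  shows "mat_mod p (mat_mod p A * B) = mat_mod p (A * B)"
proof (rule eq_matI)
  fix i j assume "i < dim_row (mat_mod p (A * B))" "j < dim_col (mat_mod p (A * B))"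
  then have ij: "i < n" "j < k" using assms by (auto simp: mat_mod_def)
  have "(\<Sum>l=0..<m. (A $$ (i, l) mod p) * B $$ (l, j)) mod p = (\<Sum>l=0..<m. A $$ (i, l) * B $$ (l, j)) mod p"
    by (subst (1 2) mod_sum_eq[symmetric]) (simp add: mod_mult_left_eq)
  then show "mat_mod p (mat_mod p A * B) $$ (i, j) = mat_mod p (A * B) $$ (i, j)"
    using ij assms by (simp add: mat_mod_def scalar_prod_def)
qed (use assms in \<open>auto simp: mat_mod_def\<close>)

text \<open>Similarity without an inverse: \<open>(X - A) K = X K - A K\<close> is congruent to
  \<open>X K - K C = K (X - C)\<close>. Taking determinants leaves the factor \<open>det K\<close>,
  which cancels coefficientwise because it is a unit modulo \<open>p\<close>.\<close>

lemma char_poly_eq_m: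
  assumes A: "A \<in> carrier_mat n n" and C: "C \<in> carrier_mat n n" and K: "K \<in> carrier_mat n n"
    and unit: "\<not> p dvd det K" and eq: "mat_mod p (A * K) = mat_mod p (K * C)"
  shows "char_poly A =m char_poly C"
proof -
  define c where "c = (\<lambda>a::int. [:a:])"
  have K': "map_mat c K \<in> carrier_mat n n" using K by simp
  interpret c: comm_ring_hom c by unfold_locales (auto simp: c_def)
  have dK: "det (map_mat c K) = [:det K:]" by (simp add: c_def c.hom_det[unfolded c_def])
  have 1: "(char_poly_matrix A * map_mat c K) $$ (i, j) = [:0, 1:] * c (K $$ (i, j)) - c ((A * K) $$ (i, j))"
    if "i < n" "j < n" for i j
  proof -
    have "(char_poly_matrix A * map_mat c K) $$ (i, j) =
      (\<Sum>l=0..<n. ((if i = l then [:0, 1:] else 0) - c (A $$ (i, l))) * c (K $$ (l, j)))"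
      using that A K by (auto simp: scalar_prod_def char_poly_matrix_def c_def intro!: sum.cong)
    also have "\<dots> = (\<Sum>l=0..<n. if i = l then [:0, 1:] * c (K $$ (i, j)) else 0) -
        (\<Sum>l=0..<n. c (A $$ (i, l) * K $$ (l, j)))"
      unfolding sum_subtractf[symmetric] by (intro sum.cong) (auto simp: left_diff_distrib c.hom_mult)
    finally show ?thesis using that A K by (simp add: scalar_prod_def c.hom_sum)
  qed
  have 2: "(map_mat c K * char_poly_matrix C) $$ (i, j) = [:0, 1:] * c (K $$ (i, j)) - c ((K * C) $$ (i, j))"
    if "i < n" "j < n" for i j
  proof -
    have "(map_mat c K * char_poly_matrix C) $$ (i, j) =
      (\<Sum>l=0..<n. c (K $$ (i, l)) * ((if l = j then [:0, 1:] else 0) - c (C $$ (l, j))))"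
      using that C K by (auto simp: scalar_prod_def char_poly_matrix_def c_def intro!: sum.cong)
    also have "\<dots> = (\<Sum>l=0..<n. if l = j then [:0, 1:] * c (K $$ (i, j)) else 0) -
        (\<Sum>l=0..<n. c (K $$ (i, l) * C $$ (l, j)))"
      unfolding sum_subtractf[symmetric] by (intro sum.cong) (auto simp: right_diff_distrib c.hom_mult)
    finally show ?thesis using that C K by (simp add: scalar_prod_def c.hom_sum)
  qed
  have "det (char_poly_matrix A * map_mat c K) =m det (map_mat c K * char_poly_matrix C)"
  proof (rule det_cong_m)
    fix i j assume ij: "i < n" "j < n"
    have "p dvd (A * K) $$ (i, j) - (K * C) $$ (i, j)"
      using eq ij A K C by (simp add: mat_mod_eq_iff[of _ n n])
    then have "c ((A * K) $$ (i, j)) =m c ((K * C) $$ (i, j))"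
      by (intro poly_eqI) (auto simp: Mp_coeff c_def coeff_pCons M_def mod_eq_dvd_iff split: nat.splits)
    then show "(char_poly_matrix A * map_mat c K) $$ (i, j) =m (map_mat c K * char_poly_matrix C) $$ (i, j)"
      unfolding 1[OF ij] 2[OF ij] by (metis minus_Mp(2))
  qed (use char_poly_matrix_closed[OF A] char_poly_matrix_closed[OF C] K' in \<open>auto intro: mult_carrier_mat\<close>)
  then have "[:det K:] * char_poly A =m [:det K:] * char_poly C"
    using det_mult[OF char_poly_matrix_closed[OF A] K'] det_mult[OF K' char_poly_matrix_closed[OF C]] dK
    by (simp add: char_poly_def mult.commute)
  then have "M (det K * coeff (char_poly A) i) = M (det K * coeff (char_poly C) i)" for i
    using Mp_coeff[of "[:det K:] * char_poly A" i] Mp_coeff[of "[:det K:] * char_poly C" i] by simp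
  then have dvd: "p dvd det K * (coeff (char_poly A) i - coeff (char_poly C) i)" for i
    by (simp add: M_def mod_eq_dvd_iff right_diff_distrib)
  show ?thesis
  proof (rule poly_eqI)
    fix i
    have "p dvd coeff (char_poly A) i - coeff (char_poly C) i"
      using dvd[of i] unit prime prime_dvd_mult_iff by blast
    then show "coeff (Mp (char_poly A)) i = coeff (Mp (char_poly C)) i"
      by (simp add: Mp_coeff M_def mod_eq_dvd_iff)
  qed
qed

end

text \<open>The possible Krylov bases of the first basis vector.\<close>

definition frames :: "int \<Rightarrow> nat \<Rightarrow> int mat set" where
  "frames p n = {K \<in> mats_over n {0..<p}. (\<forall>i<n. K $$ (i, 0) = (if i = 0 then 1 else 0)) \<and> \<not> p dvd det K}"

text \<open>Extends a frame by one row and one column. The new row starts with 0 so that the first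
  column remains the first basis vector.\<close>

definition border :: "nat \<Rightarrow> int mat \<Rightarrow> (nat \<Rightarrow> int) \<Rightarrow> (nat \<Rightarrow> int) \<Rightarrow> int \<Rightarrow> int mat" where
  "border n K u w t = mat (Suc n) (Suc n) (\<lambda>(i, j).
     if i < n then (if j < n then K $$ (i, j) else u i)
     else if j < n then (if j = 0 then 0 else w j) else t)"

lemma border_carrier [simp]: "border n K u w t \<in> carrier_mat (Suc n) (Suc n)"
  by (simp add: border_def)

text \<open>The cofactors along the last row do not involve \<open>t\<close>, so the determinant is
  affine in \<open>t\<close> with slope \<open>det K\<close>.\<close>

lemma det_border:
  assumes "K \<in> carrier_mat n n"
  shows "det (border n K u w t) = t * det K + det (border n K u w 0)"
proof -
  have del: "mat_delete (border n K u w t) n j = mat_delete (border n K u w 0) n j" for j t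
    by (intro eq_matI) (auto simp: mat_delete_def border_def)
  have "mat_delete (border n K u w 0) n n = K"
    using assms by (intro eq_matI) (auto simp: mat_delete_def border_def)
  then have cof: "cofactor (border n K u w 0) n n = det K"
    by (simp add: cofactor_def flip: mult_2)
  have row: "j < n \<Longrightarrow> border n K u w t $$ (n, j) = (if j = 0 then 0 else w j)"
    "border n K u w t $$ (n, n) = t" for j t
    by (simp_all add: border_def)
  have expand: "det (border n K u w t) = (\<Sum>j<n. (if j = 0 then 0 else w j) * cofactor (border n K u w 0) n j) + t * det K" for t
  proof -
    have "det (border n K u w t) = (\<Sum>j<Suc n. border n K u w t $$ (n, j) * cofactor (border n K u w t) n j)"
      by (rule laplace_expansion_row) simp_all
    also have "\<dots> = (\<Sum>j<Suc n. border n K u w t $$ (n, j) * cofactor (border n K u w 0) n j)"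
      unfolding cofactor_def del[of t] by simp
    also have "\<dots> = (\<Sum>j<n. border n K u w t $$ (n, j) * cofactor (border n K u w 0) n j) + t * det K"
      by (simp add: cof row(2))
    also have "(\<Sum>j<n. border n K u w t $$ (n, j) * cofactor (border n K u w 0) n j) =
        (\<Sum>j<n. (if j = 0 then 0 else w j) * cofactor (border n K u w 0) n j)"
      by (intro sum.cong refl) (simp add: row(1))
    finally show ?thesis .
  qed
  show ?thesis using expand[of t] expand[of 0] by simp
qed

text \<open>An affine function whose slope is a unit modulo \<open>p\<close> vanishes at no more
  than one residue.\<close>

lemma card_border_last:
  fixes p :: int
  assumes p: "prime p" and K: "K \<in> carrier_mat n n" "\<not> p dvd det K"
  shows "card {t \<in> {0..<p}. \<not> p dvd det (border n K u w t)} \<ge> nat p - 1"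
proof -
  let ?Z = "{t \<in> {0..<p}. p dvd det (border n K u w t)}"
  have "s = t" if "s \<in> ?Z" "t \<in> ?Z" for s t
  proof -
    have "p dvd (s * det K + det (border n K u w 0)) - (t * det K + det (border n K u w 0))"
      using that by (intro dvd_diff) (simp_all add: det_border[OF K(1), symmetric])
    then have "p dvd (s - t) * det K" by (simp add: algebra_simps)
    then have "p dvd s - t" using K(2) p prime_dvd_mult_iff by blast
    then have "s mod p = t mod p" by (simp add: mod_eq_dvd_iff)
    then show ?thesis using that by simp
  qed
  moreover have fin: "finite ?Z" by (rule finite_subset[of _ "{0..<p}"]) auto
  ultimately have "card ?Z \<le> Suc 0" using card_le_Suc0_iff_eq[of ?Z] by blast
  moreover have "{t \<in> {0..<p}. \<not> p dvd det (border n K u w t)} = {0..<p} - ?Z" by auto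
  moreover have "card ({0..<p} - ?Z) = card {0..<p} - card ?Z"
    by (intro card_Diff_subset fin) auto
  ultimately show ?thesis by simp
qed

text \<open>Bordering is injective: \<open>u\<close> has \<open>n\<close> free entries,
  \<open>w\<close> has \<open>n - 1\<close> because its first place is fixed, and at least
  \<open>p - 1\<close> corners \<open>t\<close> keep the determinant a unit.\<close>

lemma card_frames_Suc:
  fixes p :: int
  assumes p: "prime p" and n: "n \<ge> 1"
  shows "card (frames p n) * (nat p ^ (2 * n - 1) * (nat p - 1)) \<le> card (frames p (Suc n))"
proof -
  define T where "T = (\<lambda>(K, u, w). {t \<in> {0..<p}. \<not> p dvd det (border n K u w t)})"
  define X where "X = frames p n \<times> (({..<n} \<rightarrow>\<^sub>E {0..<p}) \<times> ({1..<n} \<rightarrow>\<^sub>E {0..<p}))"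
  define b where "b = (\<lambda>((K, u, w), t). border n K u w t)"
  have fin_frames: "finite (frames p m)" for m
    by (rule finite_subset[OF _ finite_mats_over[of "{0..<p}" m]]) (auto simp: frames_def)
  have finX: "finite X" unfolding X_def by (intro finite_cartesian_product fin_frames finite_PiE) auto
  have p0: "p > 0" using p prime_gt_0_int by blast
  have nth: "border n K u w t $$ (i, j) =
      (if i < n then (if j < n then K $$ (i, j) else u i) else if j < n then (if j = 0 then 0 else w j) else t)"
    if "i < Suc n" "j < Suc n" for K u w t i j
    using that by (simp add: border_def)
  have "inj_on b (Sigma X T)"
  proof (rule inj_onI)
    fix x y assume x: "x \<in> Sigma X T" and y: "y \<in> Sigma X T" and eq: "b x = b y"
    obtain K u w t where xs: "x = ((K, u, w), t)" by (metis surj_pair)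
    obtain K' u' w' t' where ys: "y = ((K', u', w'), t')" by (metis surj_pair)
    have e: "border n K u w t $$ (i, j) = border n K' u' w' t' $$ (i, j)" for i j
      using eq by (simp add: b_def xs ys)
    have "K = K'"
    proof (rule eq_matI)
      fix i j assume "i < dim_row K'" "j < dim_col K'"
      then show "K $$ (i, j) = K' $$ (i, j)" using e[of i j] y ys
        by (auto simp: X_def frames_def mats_over_def nth)
    qed (use x y xs ys in \<open>auto simp: X_def frames_def mats_over_def\<close>)
    moreover have "u = u'"
    proof (rule PiE_ext)
      show "u \<in> {..<n} \<rightarrow>\<^sub>E {0..<p}" "u' \<in> {..<n} \<rightarrow>\<^sub>E {0..<p}" using x y xs ys by (auto simp: X_def)
      fix i assume "i \<in> {..<n}"
      then show "u i = u' i" using e[of i n] by (simp add: nth)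
    qed
    moreover have "w = w'"
    proof (rule PiE_ext)
      show "w \<in> {1..<n} \<rightarrow>\<^sub>E {0..<p}" "w' \<in> {1..<n} \<rightarrow>\<^sub>E {0..<p}" using x y xs ys by (auto simp: X_def)
      fix j assume "j \<in> {1..<n}"
      then show "w j = w' j" using e[of n j] by (simp add: nth)
    qed
    moreover have "t = t'" using e[of n n] by (simp add: nth)
    ultimately show "x = y" by (simp add: xs ys)
  qed
  moreover have "b ` Sigma X T \<subseteq> frames p (Suc n)"
  proof (rule image_subsetI)
    fix x assume x: "x \<in> Sigma X T"
    obtain K u w t where xs: "x = ((K, u, w), t)" by (metis surj_pair)
    have K: "\<And>i j. i < n \<Longrightarrow> j < n \<Longrightarrow> K $$ (i, j) \<in> {0..<p}"
      "\<And>i. i < n \<Longrightarrow> K $$ (i, 0) = (if i = 0 then 1 else 0)"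
      and u: "\<And>i. i < n \<Longrightarrow> u i \<in> {0..<p}" and w: "\<And>j. 1 \<le> j \<Longrightarrow> j < n \<Longrightarrow> w j \<in> {0..<p}"
      and t: "t \<in> {0..<p}" "\<not> p dvd det (border n K u w t)"
      using x by (auto simp: xs X_def T_def frames_def mats_over_def PiE_iff)
    have "border n K u w t $$ (i, j) \<in> {0..<p}" if "i < Suc n" "j < Suc n" for i j
      unfolding nth[OF that] using K(1)[of i j] u[of i] w[of j] t(1) p0 by auto
    moreover have "border n K u w t $$ (i, 0) = (if i = 0 then 1 else 0)" if "i < Suc n" for i
      using nth[OF that, of 0] K(2)[of i] n that by auto
    ultimately show "b x \<in> frames p (Suc n)"
      using t(2) unfolding frames_def mats_over_def b_def xs by simp
  qed
  ultimately have "card (Sigma X T) \<le> card (frames p (Suc n))"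
    using fin_frames by (intro card_inj_on_le)
  moreover have "card (Sigma X T) = (\<Sum>x\<in>X. card (T x))"
  proof (intro card_SigmaI finX ballI)
    show "finite (T x)" for x
      by (rule finite_subset[of _ "{0..<p}"]) (auto simp: T_def split: prod.splits)
  qed
  moreover have "(\<Sum>x\<in>X. nat p - 1) \<le> (\<Sum>x\<in>X. card (T x))"
  proof (rule sum_mono)
    fix x assume x: "x \<in> X"
    obtain K u w where xs: "x = (K, u, w)" by (metis surj_pair)
    show "nat p - 1 \<le> card (T x)"
      using x card_border_last[OF p, of K n u w] by (auto simp: xs X_def T_def frames_def mats_over_def)
  qed
  moreover have "card X = card (frames p n) * nat p ^ (2 * n - 1)"
    using n by (simp add: X_def card_cartesian_product card_PiE flip: power_add) (simp add: mult_2)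
  ultimately show ?thesis by (simp add: mult.assoc)
qed

text \<open>The exponents add up by \<open>(n + 1)^2 = n^2 + (2 * n + 1)\<close>. Iterated bordering
  reaches the frames whose leading principal minors are all units modulo \<open>p\<close>, already a
  positive proportion.\<close>

lemma card_frames:
  fixes p :: int
  assumes p: "prime p"
  shows "nat p ^ (n * n) * (nat p - 1) ^ n \<le> card (frames p (Suc n))"
proof (induction n)
  case 0
  have p1: "p > 1" using p prime_gt_1_int by blast
  have "1\<^sub>m 1 \<in> frames p (Suc 0)" using p1 by (simp add: frames_def mats_over_def)
  moreover have "finite (frames p (Suc 0))"
    by (rule finite_subset[OF _ finite_mats_over[of "{0..<p}" "Suc 0"]]) (auto simp: frames_def)
  ultimately have "card (frames p (Suc 0)) > 0" using card_gt_0_iff by blast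
  then show ?case by simp
next
  case (Suc n)
  have "nat p ^ (Suc n * Suc n) * (nat p - 1) ^ Suc n =
     nat p ^ (n * n) * (nat p - 1) ^ n * (nat p ^ (2 * Suc n - 1) * (nat p - 1))"
  proof -
    have e: "Suc n * Suc n = n * n + (2 * Suc n - 1)" by simp
    show ?thesis unfolding e power_add power_Suc by (simp only: mult_ac)
  qed
  also have "\<dots> \<le> card (frames p (Suc n)) * (nat p ^ (2 * Suc n - 1) * (nat p - 1))"
    using Suc by (intro mult_right_mono) auto
  also have "\<dots> \<le> card (frames p (Suc (Suc n)))" by (intro card_frames_Suc p) simp
  finally show ?case .
qed

section \<open>Counting matrices with irreducible characteristic polynomial modulo p\<close>

context poly_mod_prime
begin

lemma exists_conjugate_companion:
  assumes K: "K \<in> frames p n" and f: "f \<in> irrs n"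
  shows "\<exists>A \<in> mats_over n {0..<p}. mat_mod p (A * K) = mat_mod p (K * companion f)"
proof -
  have Kc: "K \<in> carrier_mat n n" and unit: "\<not> p dvd det K"
    using K by (auto simp: frames_def mats_over_def)
  have deg: "degree f = n" using f by (simp add: irrs_def)
  have Cc: "companion f \<in> carrier_mat n n" using companion_carrier[of f] deg by simp
  note adj = adj_mat[OF Kc]
  have "algebraic_semidom_class.coprime p (det K)" using prime unit by (rule prime_imp_coprime)
  then have "gcd p (det K) = 1" by simp
  then obtain w e where e: "w * p + e * det K = 1" using bezout_int[of p "det K"] by auto
  \<comment> \<open>\<open>e\<close> inverts \<open>det K\<close> modulo \<open>p\<close>, so
    \<open>e\<close> times the adjugate stands in for the inverse of \<open>K\<close>.\<close>
  define B where "B = (e \<cdot>\<^sub>m (K * companion f)) * adj_mat K"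
  have Bc: "B \<in> carrier_mat n n" unfolding B_def
    by (rule mult_carrier_mat[OF smult_carrier_mat[OF mult_carrier_mat[OF Kc Cc]] adj(1)])
  have "B * K = (e \<cdot>\<^sub>m (K * companion f)) * (adj_mat K * K)"
    unfolding B_def using Kc Cc adj by (intro assoc_mult_mat[of _ n n _ n _ n]) auto
  also have "\<dots> = (e * det K) \<cdot>\<^sub>m (K * companion f)"
    unfolding adj using Kc Cc by (intro eq_matI) auto
  finally have BK: "B * K = (e * det K) \<cdot>\<^sub>m (K * companion f)" .
  have "mat_mod p (mat_mod p B * K) = mat_mod p (B * K)" by (rule mat_mod_mult_left[OF Bc Kc])
  also have "\<dots> = mat_mod p (K * companion f)"
    unfolding BK
  proof (subst mat_mod_eq_iff[of _ n n])
    have "e * det K * x - x = p * (- w * x)" for x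
    proof -
      have "e * det K = 1 - w * p" using e by simp
      then show ?thesis by (simp only:) (simp add: algebra_simps)
    qed
    then show "\<forall>i<n. \<forall>j<n. p dvd (e * det K \<cdot>\<^sub>m (K * companion f)) $$ (i, j) - (K * companion f) $$ (i, j)"
      using Kc Cc by (auto simp del: index_mult_mat(1))
  qed (use Kc Cc in auto)
  finally show ?thesis using mat_mod_in_mats_over[OF Bc, of p] m1 by auto
qed

text \<open>The columns of K are the iterates of the first basis vector under A.\<close>

lemma frame_unique:
  assumes K: "K \<in> frames p n" "K' \<in> frames p n" and f: "f \<in> irrs n" "f' \<in> irrs n"
    and A: "A \<in> carrier_mat n n"
    and eq: "mat_mod p (A * K) = mat_mod p (K * companion f)"
      "mat_mod p (A * K') = mat_mod p (K' * companion f')"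
  shows "K = K'"
proof -
  have Kc: "K \<in> carrier_mat n n" "K' \<in> carrier_mat n n" using K by (auto simp: frames_def mats_over_def)
  \<comment> \<open>Only columns before the last are compared; they do not depend on
    \<open>f\<close>, which is why \<open>f\<close> and \<open>f'\<close> may differ here.\<close>
  have shift: "(K * companion f) $$ (i, j) = K $$ (i, Suc j)"
    if "K \<in> carrier_mat n n" "f \<in> irrs n" "i < n" "Suc j < n" for K f i j
  proof -
    have deg: "degree f = n" using that by (simp add: irrs_def)
    have "(K * companion f) $$ (i, j) = (\<Sum>l=0..<n. K $$ (i, l) * companion f $$ (l, j))"
      using that deg companion_carrier[of f] by (simp add: scalar_prod_def)
    also have "\<dots> = (\<Sum>l=0..<n. if l = Suc j then K $$ (i, l) else 0)"
      using that deg by (intro sum.cong) (auto simp: companion_def)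
    finally show ?thesis using that by simp
  qed
  have step: "p dvd (A * K) $$ (i, j) - K $$ (i, Suc j)"
    if "K \<in> carrier_mat n n" "f \<in> irrs n" "mat_mod p (A * K) = mat_mod p (K * companion f)" "i < n" "Suc j < n"
    for K f i j
  proof -
    have "companion f \<in> carrier_mat n n" using companion_carrier[of f] that(2) by (auto simp: irrs_def)
    then have "p dvd (A * K) $$ (i, j) - (K * companion f) $$ (i, j)"
      using that A by (simp add: mat_mod_eq_iff[of _ n n])
    then show ?thesis using shift that by simp
  qed
  \<comment> \<open>Columns agree one after another: the first is prescribed, and each next one is
    \<open>A\<close> times its predecessor modulo \<open>p\<close>, with entries in
    \<open>{0..<p}\<close>.\<close>
  have "\<forall>i<n. K $$ (i, j) = K' $$ (i, j)" if "j < n" for j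
    using that
  proof (induction j)
    case 0
    then show ?case using K by (simp add: frames_def)
  next
    case (Suc j)
    show ?case
    proof (intro allI impI)
      fix i assume i: "i < n"
      have "(A * K) $$ (i, j) = (A * K') $$ (i, j)"
        using Suc i A Kc by (simp add: scalar_prod_def)
      then have d': "p dvd (A * K) $$ (i, j) - K' $$ (i, Suc j)"
        using step[OF Kc(2) f(2) eq(2) i Suc.prems] by (simp only:)
      have "p dvd ((A * K) $$ (i, j) - K' $$ (i, Suc j)) - ((A * K) $$ (i, j) - K $$ (i, Suc j))"
        by (rule dvd_diff[OF d' step[OF Kc(1) f(1) eq(1) i Suc.prems]])
      then have "K $$ (i, Suc j) mod p = K' $$ (i, Suc j) mod p" by (simp add: mod_eq_dvd_iff)
      then show "K $$ (i, Suc j) = K' $$ (i, Suc j)"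
        using K i Suc.prems by (auto simp: frames_def mats_over_def)
    qed
  qed
  then show ?thesis using Kc by (intro eq_matI) auto
qed

lemma char_poly_conjugate_companion:
  assumes K: "K \<in> frames p n" and f: "f \<in> irrs n" and A: "A \<in> carrier_mat n n"
    and eq: "mat_mod p (A * K) = mat_mod p (K * companion f)"
  shows "Mp (char_poly A) = f"
proof -
  have f': "monic f" "degree f = n" "degree f > 0" "Mp f = f" using f unfolding irrs_def irr_def by auto
  have "char_poly A =m char_poly (companion f)"
    using K A eq f' companion_carrier[of f]
    by (intro char_poly_eq_m[of A n _ K]) (auto simp: frames_def mats_over_def)
  then show ?thesis using char_poly_companion[OF f'(1,3)] f'(4) by simp
qed

lemma many_irreducible_mats:
  assumes n: "n \<ge> 1" and p3: "p \<ge> 3"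
  shows "\<exists>G \<subseteq> mats_over n {0..<p}. real (card G) \<ge> 1 / (2 ^ n * n) * real_of_int p ^ (n * n) \<and>
        (\<forall>A \<in> carrier_mat n n. mat_mod p A \<in> G \<longrightarrow> irreducible (char_poly A))"
proof -
  have "\<forall>x\<in>frames p n \<times> irrs n. \<exists>B. B \<in> mats_over n {0..<p} \<and>
      mat_mod p (B * fst x) = mat_mod p (fst x * companion (snd x))"
    using exists_conjugate_companion by fastforce
  from bchoice[OF this] obtain A where
    "\<forall>x\<in>frames p n \<times> irrs n. A x \<in> mats_over n {0..<p} \<and>
      mat_mod p (A x * fst x) = mat_mod p (fst x * companion (snd x))" ..
  then have A: "A (K, f) \<in> mats_over n {0..<p}"
    "mat_mod p (A (K, f) * K) = mat_mod p (K * companion f)"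
    if "K \<in> frames p n" "f \<in> irrs n" for K f
    using that by auto
  have Ac: "A (K, f) \<in> carrier_mat n n" if "K \<in> frames p n" "f \<in> irrs n" for K f
    using A(1)[OF that] by (simp add: mats_over_def)
  define G where "G = A ` (frames p n \<times> irrs n)"
  \<comment> \<open>The matrix returns \<open>f\<close> as its reduced characteristic polynomial,
    and then \<open>K\<close> as its Krylov basis.\<close>
  have "inj_on A (frames p n \<times> irrs n)"
  proof (rule inj_onI, clarify)
    fix K f K' f' assume K: "K \<in> frames p n" "K' \<in> frames p n" and f: "f \<in> irrs n" "f' \<in> irrs n"
      and eq: "A (K, f) = A (K', f')"
    have "f = f'" using char_poly_conjugate_companion[OF K(1) f(1) Ac[OF K(1) f(1)] A(2)[OF K(1) f(1)]]
      char_poly_conjugate_companion[OF K(2) f(2) Ac[OF K(2) f(2)] A(2)[OF K(2) f(2)]] eq by simp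
    moreover have "K = K'"
      using frame_unique[OF K f Ac[OF K(1) f(1)] A(2)[OF K(1) f(1)]] A(2)[OF K(2) f(2)] eq by simp
    ultimately show "K = K' \<and> f = f'" by simp
  qed
  then have card: "card G = card (frames p n) * card (irrs n)"
    by (simp add: G_def card_image card_cartesian_product)
  obtain m where m: "n = Suc m" using n by (cases n) auto
  define q where "q = nat p"
  have q: "real q = real_of_int p" "q \<ge> 3" using p3 by (simp_all add: q_def)
  \<comment> \<open>With \<open>n = m + 1\<close> one has \<open>m * m + m + n = n * n\<close>: the
    first two exponents pay for the frames, the last for the polynomials. The losses
    \<open>2 ^ m\<close> and \<open>2 * n\<close> multiply to \<open>2 ^ n * n\<close>.\<close>
  have "real q ^ (n * n) = real (q ^ (m * m) * q ^ m * q ^ n)"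
    by (simp add: m algebra_simps flip: power_add)
  also have "real (q ^ (m * m) * q ^ m * q ^ n) \<le> real (q ^ (m * m) * (2 ^ m * (q - 1) ^ m) * (2 * n * card (irrs n)))"
    unfolding of_nat_le_iff
  proof (intro mult_le_mono order_refl)
    have "q ^ m \<le> (2 * (q - 1)) ^ m" using q by (intro power_mono) auto
    then show "q ^ m \<le> 2 ^ m * (q - 1) ^ m" by (simp add: power_mult_distrib)
    show "q ^ n \<le> 2 * n * card (irrs n)" using irrs_lower[OF n p3] by (simp add: q_def)
  qed
  also have "\<dots> = real (2 ^ n * n * ((q ^ (m * m) * (q - 1) ^ m) * card (irrs n)))"
    by (simp add: m algebra_simps)
  also have "\<dots> \<le> real (2 ^ n * n * (card (frames p n) * card (irrs n)))"
    unfolding of_nat_le_iff using card_frames[OF prime, of m]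
    by (intro mult_le_mono order_refl) (simp add: q_def m)
  finally have "1 / (2 ^ n * real n) * real_of_int p ^ (n * n) \<le> real (card G)"
    using n unfolding card q(1) by (simp add: field_simps)
  moreover have "irreducible (char_poly B)" if B: "B \<in> carrier_mat n n" "mat_mod p B \<in> G" for B
  proof -
    obtain K f where K: "K \<in> frames p n" "f \<in> irrs n" "mat_mod p B = A (K, f)"
      using B(2) by (auto simp: G_def)
    have Kc: "K \<in> carrier_mat n n" using K by (auto simp: frames_def mats_over_def)
    have "mat_mod p (B * K) = mat_mod p (K * companion f)"
      using mat_mod_mult_left[OF B(1) Kc] A(2)[OF K(1,2)] K(3) by simp
    from char_poly_conjugate_companion[OF K(1,2) B(1) this] have "irr (Mp (char_poly B))"
      using K(2) by (simp add: irrs_def)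
    then show ?thesis using degree_monic_char_poly[OF B(1)] n by (intro irreducible_if_irr_m) auto
  qed
  moreover have "G \<subseteq> mats_over n {0..<p}" using A(1) by (auto simp: G_def)
  ultimately show ?thesis by (intro exI[of _ G] conjI ballI impI)
qed

end

theorem theorem6p4:
  fixes n :: nat
  assumes "n \<ge> 2"
  shows "((\<lambda>B::real. real (N_reducible n B) / real (card (bounded_int_mats n B)))
           \<longlongrightarrow> 0) at_top"
  unfolding N_reducible_def
\<comment> \<open>The threshold 3 is inherited from \<open>irrs_lower\<close>; \<open>bad\<close> is
  reducibility, whence the double negation below.\<close>
proof (rule sieve_density[where b = 3])
  have "1 \<le> (2::real) ^ n * n" using assms mult_mono[of 1 "(2::real) ^ n" 1 "real n"] by simp
  then show "0 < 1 / ((2::real) ^ n * n)" "1 / ((2::real) ^ n * n) \<le> 1" by simp_all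
  fix p :: int assume p: "prime p" "p \<ge> int 3"
  interpret poly_mod_prime p by unfold_locales (rule p)
  show "\<exists>G\<subseteq>mats_over n {0..<p}. 1 / (2 ^ n * real n) * real_of_int p ^ (n * n) \<le> real (card G) \<and>
      (\<forall>A\<in>carrier_mat n n. mat_mod p A \<in> G \<longrightarrow> \<not> \<not> irreducible (char_poly A))"
    using many_irreducible_mats[of n] assms p by simp
qed

end
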